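(* Let $X$ be a real Banach space. The following are equivalent: (1) $X$ has the strong diameter two property (SD2P). (2) For every $n\in\mathbb{N}$ and every $\varepsilon>0$, $$B_{\ell_\infty^n(X)}=\overline{\mathrm{co}}\left(C^{n,\varepsilon}(X)\right).$$ (3) For every $n\in\mathbb{N}$ and every $\varepsilon>0$, $$B_{\ell_\infty^n(X)}\subset\overline{\mathrm{co}}\left(C^{n,\varepsilon+}(X)\right).$$
   Context: $B_X$ is the closed unit ball of $X$, and $\mathbb{N}=\{1,2,\dots\}$. A slice of $B_X$ is a set $S(B_X,f,\alpha)=\{x\in B_X: f(x)>\sup f(B_X)-\alpha\}$ with $f\in X^*$, $\alpha>0$. A convex combination of slices of $B_X$ is a set $\sum_{i=1}^n\lambda_iS_i=\{\sum_{i=1}^n\lambda_i x_i: x_i\in S_i\}$ with $n\in\mathbb{N}$, $\lambda_i>0$, $\sum_{i=1}^n\lambda_i=1$ and each $S_i$ a slice of $B_X$. $X$ has the strong diameter two property (SD2P) if every convex combination of slices of $B_X$ has diameter $2$. $\ell_\infty^n(X)$ is $X^n$ with the norm $\|(z_1,\dots,z_n)\|_\infty=\max_{1\le i\le n}\|z_i\|$. $\overline{\mathrm{co}}(C)$ denotes the norm-closed convex hull of $C$. For $n\in\mathbb{N}$ and $\varepsilon>0$, $$C^{n,\varepsilon}(X)=\left\{z\in\ell_\infty^n(X):\ \|z\|_\infty\le 1,\ \frac1n\left\|\sum_{i=1}^n z_i\right\|>1-\varepsilon\right\},$$ $$C^{n,\varepsilon+}(X)=\left\{z\in\ell_\infty^n(X):\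 \|z\|_\infty\le 1+\varepsilon,\ \frac1n\left\|\sum_{i=1}^n z_i\right\|>1-\varepsilon\right\}.$$ *)

theory Defs
  imports "HOL-Analysis.Analysis"
begin

section \<open>Slices and the strong diameter two property\<close>

definition slice :: "('a::real_normed_vector \<Rightarrow>\<^sub>L real) \<Rightarrow> real \<Rightarrow> 'a set" where
  "slice f \<alpha> = {x \<in> cball 0 1. blinfun_apply f x > (SUP y\<in>cball 0 1. blinfun_apply f y) - \<alpha>}"

definition is_slice :: "'a::real_normed_vector set \<Rightarrow> bool" where
  "is_slice S \<longleftrightarrow> (\<exists>f \<alpha>. \<alpha> > 0 \<and> S = slice f \<alpha>)"

definition is_convex_comb_of_slices :: "'a::real_normed_vector set \<Rightarrow> bool" where
  "is_convex_comb_of_slices C \<longleftrightarrow>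
     (\<exists>(n::nat) (\<mu>::nat \<Rightarrow> real) (S::nat \<Rightarrow> 'a set).
        n \<ge> 1 \<and> (\<forall>i\<in>{1..n}. \<mu> i > 0) \<and> (\<Sum>i=1..n. \<mu> i) = 1 \<and>
        (\<forall>i\<in>{1..n}. is_slice (S i)) \<and>
        C = {(\<Sum>i=1..n. \<mu> i *\<^sub>R x i) | x. \<forall>i\<in>{1..n}. x i \<in> S i})"

text \<open>
  The argument of type \<open>'a itself\<close> only carries the space: \<open>SD2P TYPE('a)\<close> is a property
  of the normed space \<open>'a\<close>.
\<close>
definition SD2P :: "'a::real_normed_vector itself \<Rightarrow> bool" where
  "SD2P _ \<longleftrightarrow> (\<forall>C::'a set. is_convex_comb_of_slices C \<longrightarrow> diameter C = 2)"

section \<open>The spaces \<open>\<ell>\<^sub>\<infinity>\<^sup>n(X)\<close>\<close>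

text \<open>
  Since \<open>nat\<close> is discrete, \<open>nat \<Rightarrow>\<^sub>C 'a\<close> is the space of all bounded sequences in \<open>'a\<close> with
  the supremum norm. The \<open>n\<close>-tuples \<open>(z 1, \<dots>, z n)\<close> are identified with the sequences
  vanishing outside \<open>{1..n}\<close>, so that \<open>n\<close> can be quantified over inside a formula while linear
  structure, norm, convex hull and closure are those of the library. The lemmas below show
  that all \<open>n\<close>-tuples occur, that the norm is the maximum norm, and that \<open>ell_inf n\<close> is a closed
  subspace, so closures and convex hulls of subsets of \<open>ell_inf n\<close> do not leave it.
\<close>
definition ell_inf :: "nat \<Rightarrow> (nat \<Rightarrow>\<^sub>C 'a::real_normed_vector) set" where
  "ell_inf n = {z. \<forall>i. i \<notin> {1..n} \<longrightarrow> apply_bcontfun z i = 0}"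

lemma ell_inf_tuple:
  fixes x :: "nat \<Rightarrow> 'a::real_normed_vector"
  shows "\<exists>!z. z \<in> ell_inf n \<and> (\<forall>i\<in>{1..n}. apply_bcontfun z i = x i)"
proof (rule ex_ex1I)
  define f where "f = (\<lambda>i. if i \<in> {1..n} then x i else 0)"
  have "range f \<subseteq> insert 0 (x ` {1..n})" by (auto simp: f_def)
  hence "finite (range f)" by (rule finite_subset) simp
  hence "f \<in> bcontfun" by (simp add: bcontfun_def finite_imp_bounded)
  hence "apply_bcontfun (Bcontfun f) = f" by (rule Bcontfun_inverse)
  thus "\<exists>z. z \<in> ell_inf n \<and> (\<forall>i\<in>{1..n}. apply_bcontfun z i = x i)"
    by (intro exI[of _ "Bcontfun f"]) (auto simp: ell_inf_def f_def)
next
  fix z w :: "nat \<Rightarrow>\<^sub>C 'a"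
  assume "z \<in> ell_inf n \<and> (\<forall>i\<in>{1..n}. apply_bcontfun z i = x i)"
    and "w \<in> ell_inf n \<and> (\<forall>i\<in>{1..n}. apply_bcontfun w i = x i)"
  hence "apply_bcontfun z i = apply_bcontfun w i" for i
    by (cases "i \<in> {1..n}") (simp_all add: ell_inf_def)
  thus "z = w" by (rule bcontfun_eqI)
qed

lemma norm_ell_inf:
  assumes "z \<in> ell_inf n" "n \<ge> 1"
  shows "norm z = Max ((\<lambda>i. norm (apply_bcontfun z i)) ` {1..n})"
proof (rule antisym)
  show "Max ((\<lambda>i. norm (apply_bcontfun z i)) ` {1..n}) \<le> norm z"
    using assms(2) by (subst Max_le_iff) (auto simp: norm_bounded)
  show "norm z \<le> Max ((\<lambda>i. norm (apply_bcontfun z i)) ` {1..n})"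
  proof (rule norm_bound)
    fix i
    have "norm (apply_bcontfun z 1) \<le> Max ((\<lambda>i. norm (apply_bcontfun z i)) ` {1..n})"
      using assms(2) by (intro Max_ge) auto
    hence "0 \<le> Max ((\<lambda>i. norm (apply_bcontfun z i)) ` {1..n})"
      using norm_ge_zero order_trans by blast
    thus "norm (apply_bcontfun z i) \<le> Max ((\<lambda>i. norm (apply_bcontfun z i)) ` {1..n})"
    proof (cases "i \<in> {1..n}")
      case True
      thus ?thesis by (intro Max_ge) simp_all
    next
      case False
      hence "apply_bcontfun z i = 0" using assms(1) unfolding ell_inf_def by blast
      thus ?thesis using \<open>0 \<le> Max _\<close> by simp
    qed
  qed
qed

lemma subspace_ell_inf: "subspace (ell_inf n)"
  by (auto simp: subspace_def ell_inf_def)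

lemma closed_ell_inf: "closed (ell_inf n)"
  unfolding closed_sequential_limits
proof safe
  fix f l
  assume f: "\<forall>k. f k \<in> ell_inf n" and lim: "f \<longlonglongrightarrow> l"
  have "apply_bcontfun l i = 0" if "i \<notin> {1..n}" for i
  proof -
    have "(\<lambda>k. apply_bcontfun (f k) i) \<longlonglongrightarrow> apply_bcontfun l i"
      using tendsto_bcontfun_uniform_limit[OF lim] by (rule tendsto_uniform_limitI) simp
    moreover have "(\<lambda>k. apply_bcontfun (f k) i) = (\<lambda>k. 0)"
      using f that unfolding ell_inf_def by blast
    ultimately show ?thesis by (simp add: LIMSEQ_const_iff)
  qed
  thus "l \<in> ell_inf n" unfolding ell_inf_def by blast
qed

definition unit_ball_ell_inf :: "nat \<Rightarrow> (nat \<Rightarrow>\<^sub>C 'a::real_normed_vector) set" where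
  "unit_ball_ell_inf n = {z \<in> ell_inf n. norm z \<le> 1}"

definition C_set :: "nat \<Rightarrow> real \<Rightarrow> (nat \<Rightarrow>\<^sub>C 'a::real_normed_vector) set" where
  "C_set n \<epsilon> = {z \<in> ell_inf n. norm z \<le> 1 \<and>
     1 / real n * norm (\<Sum>i=1..n. apply_bcontfun z i) > 1 - \<epsilon>}"

definition C_plus_set :: "nat \<Rightarrow> real \<Rightarrow> (nat \<Rightarrow>\<^sub>C 'a::real_normed_vector) set" where
  "C_plus_set n \<epsilon> = {z \<in> ell_inf n. norm z \<le> 1 + \<epsilon> \<and>
     1 / real n * norm (\<Sum>i=1..n. apply_bcontfun z i) > 1 - \<epsilon>}"

end

(*
A convex combination of slices of the unit ball has diameter 2 as soon as its slices contain points
whose unweighted sum has nearly maximal norm. This is applied to the slices together with their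
reflections. Conversely, if two points of an average of slices are nearly 2 apart, then each of them
has norm nearly 1. So SD2P means that any n slices contain x_1, ..., x_n with |x_1 + ... + x_n|
nearly n, which is what Hahn-Banach separation translates into (2), because a functional on
l_infty^n(X) is a sum of functionals f_i of the coordinates, and being nearly maximal for the sum
forces being nearly maximal for every f_i. For (3) the tuple is divided by 1 + epsilon first.

Hahn-Banach is obtained without extending functionals from subspaces: a minimal sublinear
functional is linear. The infimum of p(x + t a) - t c over t >= 0 and a in A yields both the
minimality argument (A a single point) and the separation (p the norm).
*)
theory Submission
  imports Defs
begin

section \<open>Sublinear functionals, minimality, and separation of a point from a closed convex
  set\<close>

section \<open>Hahn--Banach separation\<close>

text \<open>Homogeneity is required only as an inequality, which is what infima deliver directly;
  for t > 0 the reverse inequality comes from the factor 1 / t.\<close>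

definition sublinear :: "('a::real_vector \<Rightarrow> real) \<Rightarrow> bool" where
  "sublinear p \<longleftrightarrow> (\<forall>x y. p (x + y) \<le> p x + p y) \<and> (\<forall>t\<ge>0. \<forall>x. p (t *\<^sub>R x) \<le> t * p x)"

lemma sublinear_add: "sublinear p \<Longrightarrow> p (x + y) \<le> p x + p y"
  and sublinear_scaleR_le: "sublinear p \<Longrightarrow> t \<ge> 0 \<Longrightarrow> p (t *\<^sub>R x) \<le> t * p x"
  by (auto simp: sublinear_def)

lemma sublinear_0: "sublinear p \<Longrightarrow> p 0 = 0"
  using sublinear_add[of p 0 0] sublinear_scaleR_le[of p 0 0] by simp

lemma sublinear_minus_ge: "sublinear p \<Longrightarrow> - p (- x) \<le> p x"
  using sublinear_add[of p x "- x"] sublinear_0[of p] by simp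

lemma sublinear_scaleR:
  assumes "sublinear p" "t \<ge> 0"
  shows "p (t *\<^sub>R x) = t * p x"
proof (cases "t = 0")
  case True
  thus ?thesis using assms by (simp add: sublinear_0)
next
  case False
  hence "t > 0" using assms by simp
  have "p ((1 / t) *\<^sub>R (t *\<^sub>R x)) \<le> (1 / t) * p (t *\<^sub>R x)"
    using assms by (intro sublinear_scaleR_le) auto
  hence "p x \<le> p (t *\<^sub>R x) / t"
    using \<open>t > 0\<close> by simp
  hence "t * p x \<le> p (t *\<^sub>R x)"
    using \<open>t > 0\<close> by (simp add: field_simps)
  thus ?thesis using sublinear_scaleR_le[OF assms, of x] by simp
qed

lemma sublinear_norm: "sublinear (norm :: 'a::real_normed_vector \<Rightarrow> real)"
  by (simp add: sublinear_def norm_triangle_ineq)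

text \<open>The infimum of p (x + t a) - t c does it: t = 0 gives \<open>q \<le> p\<close>, and t =
  1 at the point - a gives \<open>q (- a) \<le> - c\<close>. The bound \<open>c \<le> p a\<close>
  keeps the infimum above - p (- x), and convexity of \<open>A\<close> makes it subadditive.\<close>

lemma sublinear_minorant:
  assumes p: "sublinear p" and A: "convex A" "A \<noteq> {}" and c: "\<And>a. a \<in> A \<Longrightarrow> c \<le> p a"
  obtains q where "sublinear q" "q \<le> p" "\<And>a. a \<in> A \<Longrightarrow> q (- a) \<le> - c"
proof -
  define q where "q x = (INF (t, a) \<in> {0..} \<times> A. p (x + t *\<^sub>R a) - t * c)" for x
  have bound: "- p (- x) \<le> p (x + t *\<^sub>R a) - t * c" if "t \<ge> 0" "a \<in> A" for x t a
  proof -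
    have "t * c \<le> t * p a" using that c by (simp add: mult_left_mono)
    also have "\<dots> = p ((x + t *\<^sub>R a) + (- x))" using that p by (simp add: sublinear_scaleR)
    also have "\<dots> \<le> p (x + t *\<^sub>R a) + p (- x)" using p by (rule sublinear_add)
    finally show ?thesis by simp
  qed
  have bdd: "bdd_below ((\<lambda>(t, a). p (x + t *\<^sub>R a) - t * c) ` ({0..} \<times> A))" for x
    by (rule bdd_belowI[of _ "- p (- x)"]) (use bound in auto)
  have q_le: "q x \<le> p (x + t *\<^sub>R a) - t * c" if "t \<ge> 0" "a \<in> A" for x t a
    unfolding q_def using cINF_lower[OF bdd, of "(t, a)" x] that by simp
  have q_ge: "r \<le> q x" if "\<And>t a. t \<ge> 0 \<Longrightarrow> a \<in> A \<Longrightarrow> r \<le> p (x + t *\<^sub>R a) - t * c" for r x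
    unfolding q_def by (rule cINF_greatest) (use that A in auto)
  have le: "q x \<le> p x" for x
    using q_le[of 0 _ x] A by auto
  have "q (x + y) \<le> q x + q y" for x y
  proof -
    have *: "q (x + y) \<le> (p (x + t *\<^sub>R a) - t * c) + (p (y + s *\<^sub>R b) - s * c)"
      if ts: "t \<ge> 0" "a \<in> A" "s \<ge> 0" "b \<in> A" for t a s b
    proof -
      \<comment> \<open>By convexity t a + s b is t + s times a single point of \<open>A\<close>, so
        the two shifts merge into one; if t + s = 0, any point of \<open>A\<close> serves.\<close>
      obtain k where k: "k \<in> A" "(t + s) *\<^sub>R k = t *\<^sub>R a + s *\<^sub>R b"
      proof (cases "t + s = 0")
        case True
        hence "t = 0" "s = 0" using ts by auto
        thus ?thesis using ts by (intro that[of a]) auto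
      next
        case False
        have "(t / (t + s)) *\<^sub>R a + (s / (t + s)) *\<^sub>R b \<in> A"
          using ts False by (intro convexD[OF A(1)]) (auto simp flip: add_divide_distrib)
        moreover have "(t + s) *\<^sub>R ((t / (t + s)) *\<^sub>R a + (s / (t + s)) *\<^sub>R b) = t *\<^sub>R a + s *\<^sub>R b"
          using False by (simp add: scaleR_add_right)
        ultimately show ?thesis by (rule that)
      qed
      have "q (x + y) \<le> p (x + y + (t + s) *\<^sub>R k) - (t + s) * c"
        using ts k by (intro q_le) auto
      also have "x + y + (t + s) *\<^sub>R k = (x + t *\<^sub>R a) + (y + s *\<^sub>R b)"
        by (subst k(2)) (simp add: algebra_simps)
      also have "p \<dots> \<le> p (x + t *\<^sub>R a) + p (y + s *\<^sub>R b)"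
        using p by (rule sublinear_add)
      finally show ?thesis by (simp add: algebra_simps)
    qed
    \<comment> \<open>The two infima are taken one after the other: first over (s, b), then over (t,
      a).\<close>
    have "q (x + y) - (p (x + t *\<^sub>R a) - t * c) \<le> q y" if "t \<ge> 0" "a \<in> A" for t a
      by (rule q_ge) (use *[OF that] in \<open>auto simp: algebra_simps\<close>)
    hence "q (x + y) - q y \<le> q x"
      by (intro q_ge) (force simp: algebra_simps)
    thus ?thesis by simp
  qed
  moreover have "q (r *\<^sub>R x) \<le> r * q x" if "r \<ge> 0" for r x
  proof (cases "r = 0")
    case True
    thus ?thesis using le[of 0] p by (simp add: sublinear_0)
  next
    case False
    with that have r: "r > 0" by simp
    have "q (r *\<^sub>R x) / r \<le> q x"
    proof (rule q_ge)
      fix t a assume ta: "t \<ge> (0::real)" "a \<in> A"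
      \<comment> \<open>The parameter r t in place of t lets the factor r be pulled out of the whole
        expression.\<close>
      have "q (r *\<^sub>R x) \<le> p (r *\<^sub>R x + (r * t) *\<^sub>R a) - (r * t) * c"
        using ta r by (intro q_le) auto
      also have "r *\<^sub>R x + (r * t) *\<^sub>R a = r *\<^sub>R (x + t *\<^sub>R a)"
        by (simp add: algebra_simps)
      also have "p \<dots> = r * p (x + t *\<^sub>R a)"
        using p r by (simp add: sublinear_scaleR)
      finally show "q (r *\<^sub>R x) / r \<le> p (x + t *\<^sub>R a) - t * c"
        using r by (simp add: field_simps)
    qed
    thus ?thesis using r by (simp add: field_simps)
  qed
  ultimately have "sublinear q" by (auto simp: sublinear_def)
  moreover have "q (- a) \<le> - c" if "a \<in> A" for a
    using q_le[of 1 a "- a"] that p by (simp add: sublinear_0)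
  ultimately show ?thesis using le by (intro that[of q]) (auto simp: le_fun_def)
qed

text \<open>The minorant for the single point y and c = p y must coincide with \<open>p\<close>,
  hence p (- y) \<le> - p y. So \<open>p\<close> is odd, and oddness turns subadditivity into
  additivity.\<close>

lemma minimal_sublinear_imp_linear:
  assumes p: "sublinear p" and min: "\<And>q. sublinear q \<Longrightarrow> q \<le> p \<Longrightarrow> q = p"
  shows "linear p"
proof -
  have minus: "p (- y) = - p y" for y
  proof -
    obtain q where "sublinear q" "q \<le> p" "\<And>a. a \<in> {y} \<Longrightarrow> q (- a) \<le> - p y"
      by (rule sublinear_minorant[OF p, of "{y}" "p y"]) auto
    hence "p (- y) \<le> - p y" using min[of q] by auto
    thus ?thesis using sublinear_minus_ge[OF p, of y] by simp
  qed
  show ?thesis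
  proof (rule linearI)
    fix x y
    have "p (- x + - y) \<le> p (- x) + p (- y)" using p by (rule sublinear_add)
    moreover have "p (- x + - y) = - p (x + y)" using minus[of "x + y"] by simp
    ultimately show "p (x + y) = p x + p y"
      using sublinear_add[OF p, of x y] by (simp add: minus)
  next
    fix r x
    show "p (r *\<^sub>R x) = r *\<^sub>R p x"
    proof (cases "r \<ge> 0")
      case True
      thus ?thesis using p by (simp add: sublinear_scaleR)
    next
      case False
      hence "p ((- r) *\<^sub>R x) = (- r) * p x" using p by (intro sublinear_scaleR) auto
      thus ?thesis by (simp add: minus)
    qed
  qed
qed

text \<open>The pointwise infimum is finite because - p (- x) bounds every member from below. It is
  subadditive because of two members of a chain one lies below both.\<close>

lemma chain_Inf_sublinear:
  assumes p: "sublinear p" and C: "C \<noteq> {}"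
    and sub: "\<And>q. q \<in> C \<Longrightarrow> sublinear q \<and> q \<le> p"
    and chain: "\<And>q r. q \<in> C \<Longrightarrow> r \<in> C \<Longrightarrow> q \<le> r \<or> r \<le> q"
  obtains u where "sublinear u" "\<And>q. q \<in> C \<Longrightarrow> u \<le> q"
proof -
  define u where "u x = (INF q\<in>C. q x)" for x
  have bdd: "bdd_below ((\<lambda>q. q x) ` C)" for x
  proof (rule bdd_belowI[of _ "- p (- x)"])
    fix v assume "v \<in> (\<lambda>q. q x) ` C"
    then obtain q where q: "q \<in> C" "v = q x" by auto
    have "q (- x) \<le> p (- x)" using sub[OF q(1)] by (auto simp: le_fun_def)
    moreover have "- q (- x) \<le> q x" using sub[OF q(1)] by (auto intro: sublinear_minus_ge)
    ultimately show "- p (- x) \<le> v" using q by simp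
  qed
  have u_le: "u x \<le> q x" if "q \<in> C" for q x
    unfolding u_def using that by (intro cINF_lower[OF bdd])
  have u_ge: "r \<le> u x" if "\<And>q. q \<in> C \<Longrightarrow> r \<le> q x" for r x
    unfolding u_def using C that by (intro cINF_greatest)
  have "u (x + y) \<le> u x + u y" for x y
  proof -
    have *: "u (x + y) \<le> q x + r y" if qr: "q \<in> C" "r \<in> C" for q r
    proof -
      obtain m where m: "m \<in> C" "m \<le> q" "m \<le> r" using chain[OF qr] qr by auto
      have "u (x + y) \<le> m (x + y)" using m by (intro u_le)
      also have "\<dots> \<le> m x + m y" using sub[OF m(1)] by (auto intro: sublinear_add)
      also have "\<dots> \<le> q x + r y" using m by (auto simp: le_fun_def intro: add_mono)
      finally show ?thesis .
    qed
    have "u (x + y) - q x \<le> u y" if "q \<in> C" for q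
      by (rule u_ge) (use *[OF that] in \<open>auto simp: algebra_simps\<close>)
    hence "u (x + y) - u y \<le> u x"
      by (intro u_ge) (force simp: algebra_simps)
    thus ?thesis by simp
  qed
  moreover have "u (t *\<^sub>R x) \<le> t * u x" if "t \<ge> 0" for t x
  proof (cases "t = 0")
    case True
    obtain q where "q \<in> C" using C by auto
    thus ?thesis using True u_le[of q 0] sub[of q] by (auto simp: sublinear_0)
  next
    case False
    hence t: "t > 0" using that by simp
    have "u (t *\<^sub>R x) / t \<le> u x"
    proof (rule u_ge)
      fix q assume q: "q \<in> C"
      have "u (t *\<^sub>R x) \<le> t * q x"
        using u_le[OF q, of "t *\<^sub>R x"] sub[OF q] that by (auto simp: sublinear_scaleR)
      thus "u (t *\<^sub>R x) / t \<le> q x" using t by (simp add: field_simps)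
    qed
    thus ?thesis using t by (simp add: field_simps)
  qed
  ultimately have "sublinear u" by (auto simp: sublinear_def)
  thus ?thesis using u_le by (intro that[of u]) (auto simp: le_fun_def)
qed

text \<open>Zorn's lemma yields a minimal sublinear functional below \<open>p\<close>, and
  minimality forces linearity.\<close>

lemma ex_linear_le_sublinear:
  assumes p: "sublinear p"
  obtains f where "linear f" "f \<le> p"
proof -
  \<comment> \<open>The order \<open>?P\<close> is reversed, so that a maximal element for it is a
    minimal functional.\<close>
  let ?A = "{q. sublinear q \<and> q \<le> p}" and ?P = "\<lambda>q r::'a \<Rightarrow> real. r \<le> q"
  have "\<exists>m\<in>?A. \<forall>a\<in>?A. ?P m a \<longrightarrow> a = m"
  proof (rule predicate_Zorn)
    show "partial_order_on ?A (relation_of ?P ?A)"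
      by (rule partial_order_on_relation_ofI) auto
  next
    fix C assume C: "C \<in> Chains (relation_of ?P ?A)"
    show "\<exists>u\<in>?A. \<forall>a\<in>C. ?P a u"
    proof (cases "C = {}")
      case True
      thus ?thesis using p by auto
    next
      case False
      obtain u where u: "sublinear u" "\<And>q. q \<in> C \<Longrightarrow> u \<le> q"
        by (rule chain_Inf_sublinear[OF p False])
          (use C in \<open>auto simp: Chains_def relation_of_def\<close>)
      obtain q where "q \<in> C" using False by auto
      hence "u \<le> q" "q \<le> p" using u C by (auto simp: Chains_def relation_of_def)
      hence "u \<le> p" by (rule order_trans)
      thus ?thesis using u by auto
    qed
  qed
  then obtain m where m: "sublinear m" "m \<le> p"
    and min: "\<And>a. sublinear a \<Longrightarrow> a \<le> p \<Longrightarrow> a \<le> m \<Longrightarrow> a = m" by auto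
  have "linear m"
    using m(1) by (rule minimal_sublinear_imp_linear) (use min m order_trans in blast)
  thus ?thesis using m that by blast
qed

text \<open>With d a positive lower bound for the distances from z to \<open>K\<close>, all points z
  - k have norm at least d. A minorant of the norm is then at most - d at k - z, and a linear
  functional below it satisfies f k \<le> f z - d; lying below the norm makes it bounded.\<close>

theorem separating_blinfun:
  fixes K :: "'a::real_normed_vector set"
  assumes K: "closed K" "convex K" "z \<notin> K"
  obtains f :: "'a \<Rightarrow>\<^sub>L real" and b where "\<And>k. k \<in> K \<Longrightarrow> f k \<le> b" "b < f z"
proof (cases "K = {}")
  case True
  thus ?thesis by (intro that[of 0 "-1"]) auto
next
  case False
  obtain d where d: "d > 0" "\<And>k. k \<in> K \<Longrightarrow> d \<le> dist z k"
  proof -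
    have "open (- K)" "z \<in> - K" using K by (auto simp: open_closed)
    then obtain e where "e > 0" "ball z e \<subseteq> - K" by (auto simp: open_contains_ball)
    thus ?thesis by (intro that[of e]) (force simp: not_less[symmetric])+
  qed
  let ?A = "(\<lambda>k. z - k) ` K"
  have "convex ?A"
    using convex_translation[OF convex_negations[OF K(2)], of z] by (simp add: image_image)
  moreover have "d \<le> norm a" if "a \<in> ?A" for a
    using that d by (auto simp: dist_norm)
  ultimately obtain q where q: "sublinear q" "q \<le> norm" "\<And>a. a \<in> ?A \<Longrightarrow> q (- a) \<le> - d"
    using sublinear_minorant[OF sublinear_norm, of ?A d] False by blast
  obtain f where f: "linear f" "f \<le> q"
    using ex_linear_le_sublinear[OF q(1)] .
  have f_le: "f x \<le> norm x" for x
    using f q(2) by (meson le_funD order_trans)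
  have "bounded_linear f"
  proof (rule bounded_linear_intro[where K = 1])
    show "norm (f x) \<le> norm x * 1" for x
      using f_le[of x] f_le[of "- x"] linear_neg[OF f(1), of x] by (simp add: abs_le_iff)
  qed (simp_all add: linear_add[OF f(1)] linear_scale[OF f(1)])
  hence eq: "blinfun_apply (Blinfun f) = f" by (rule bounded_linear_Blinfun_apply)
  have "f k \<le> f z - d" if "k \<in> K" for k
  proof -
    have "f (- (z - k)) \<le> q (- (z - k))" using f(2) by (rule le_funD)
    also have "\<dots> \<le> - d" using that by (intro q) auto
    finally show ?thesis using f(1) by (simp add: linear_diff)
  qed
  thus ?thesis using d(1) by (intro that[of "Blinfun f" "f z - d"]) (auto simp: eq)
qed

section \<open>Slices in terms of the operator norm, and SD2P as a statement on unweighted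
  sums\<close>

section \<open>Slices\<close>

lemma blinfun_le_norm:
  fixes f :: "'a::real_normed_vector \<Rightarrow>\<^sub>L real"
  assumes "norm y \<le> r"
  shows "f y \<le> norm f * r"
proof -
  have "f y \<le> norm f * norm y" using norm_blinfun[of f y] by simp
  also have "\<dots> \<le> norm f * r" using assms by (intro mult_left_mono) auto
  finally show ?thesis .
qed

lemma bdd_above_blinfun_cball:
  fixes f :: "'a::real_normed_vector \<Rightarrow>\<^sub>L real"
  shows "bdd_above (blinfun_apply f ` cball 0 1)"
  by (rule bdd_aboveI2[of _ _ "norm f"]) (use blinfun_le_norm[of _ 1 f] in auto)

text \<open>The one-sided supremum already controls the absolute value because the ball is
  symmetric: it is tested at both x and - x, normalized.\<close>

lemma SUP_cball_blinfun:
  fixes f :: "'a::real_normed_vector \<Rightarrow>\<^sub>L real"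
  shows "(SUP y\<in>cball 0 1. f y) = norm f"
proof (rule antisym)
  show "(SUP y\<in>cball 0 1. f y) \<le> norm f"
    by (intro cSUP_least) (use blinfun_le_norm[of _ 1 f] in auto)
  have ge: "f y \<le> (SUP y\<in>cball 0 1. f y)" if "y \<in> cball 0 1" for y
    using that by (intro cSUP_upper bdd_above_blinfun_cball)
  show "norm f \<le> (SUP y\<in>cball 0 1. f y)"
  proof (rule norm_blinfun_bound)
    show "0 \<le> (SUP y\<in>cball 0 1. f y)" using ge[of 0] by simp
    fix x
    show "norm (f x) \<le> (SUP y\<in>cball 0 1. f y) * norm x"
    proof (cases "x = 0")
      case False
      have "f ((1 / norm x) *\<^sub>R x) \<le> (SUP y\<in>cball 0 1. f y)"
        "f ((1 / norm x) *\<^sub>R (- x)) \<le> (SUP y\<in>cball 0 1. f y)"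
        using False by (intro ge; simp)+
      thus ?thesis
        using False by (simp add: blinfun.scaleR_right blinfun.minus_right field_simps abs_le_iff)
    qed simp
  qed
qed

lemma mem_slice: "x \<in> slice f \<alpha> \<longleftrightarrow> norm x \<le> 1 \<and> norm f - \<alpha> < f x"
  by (simp add: slice_def SUP_cball_blinfun)

text \<open>Turns a point of a reflected slice into a further point of the original slice.\<close>

lemma slice_uminus: "x \<in> slice (- f) \<alpha> \<longleftrightarrow> - x \<in> slice f \<alpha>"
  by (simp add: mem_slice blinfun.minus_left blinfun.minus_right)

lemma slice_nonempty:
  assumes "\<alpha> > 0"
  shows "slice f \<alpha> \<noteq> {}"
proof -
  have "norm f - \<alpha> < (SUP y\<in>cball 0 1. f y)"
    using assms by (simp add: SUP_cball_blinfun)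
  then obtain y where "y \<in> cball 0 1" "norm f - \<alpha> < f y"
    by (subst (asm) less_cSUP_iff) (auto simp: bdd_above_blinfun_cball)
  thus ?thesis by (auto simp: mem_slice)
qed

text \<open>
  Shrinking the weights \<open>1\<close> to \<open>\<mu> i\<close> costs at most \<open>\<Sum>i (1 - \<mu> i)\<close>, so a nearly extremal
  unweighted sum has nearly extremal convex combinations with arbitrary weights.
\<close>
lemma norm_weighted_sum_ge:
  fixes x :: "'i \<Rightarrow> 'a::real_normed_vector"
  assumes "\<And>i. i \<in> I \<Longrightarrow> norm (x i) \<le> 1" "\<And>i. i \<in> I \<Longrightarrow> \<mu> i \<le> 1"
  shows "norm (\<Sum>i\<in>I. x i) - (\<Sum>i\<in>I. 1 - \<mu> i) \<le> norm (\<Sum>i\<in>I. \<mu> i *\<^sub>R x i)"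
proof -
  have "(\<Sum>i\<in>I. x i) = (\<Sum>i\<in>I. \<mu> i *\<^sub>R x i) + (\<Sum>i\<in>I. (1 - \<mu> i) *\<^sub>R x i)"
    by (simp add: sum.distrib[symmetric] algebra_simps)
  also have "norm \<dots> \<le> norm (\<Sum>i\<in>I. \<mu> i *\<^sub>R x i) + norm (\<Sum>i\<in>I. (1 - \<mu> i) *\<^sub>R x i)"
    by (rule norm_triangle_ineq)
  also have "norm (\<Sum>i\<in>I. (1 - \<mu> i) *\<^sub>R x i) \<le> (\<Sum>i\<in>I. 1 - \<mu> i)"
    using assms by (intro sum_norm_le) (auto intro: mult_left_le)
  finally show ?thesis by simp
qed

text \<open>The hub of the equivalence: it follows from (1) and from (3), and it implies (1) and
  (2). One width \<alpha> for all slices loses nothing, since finitely many slices can be shrunk to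
  the smallest width.\<close>

definition slices_near_extremal :: "'a::real_normed_vector itself \<Rightarrow> bool" where
  "slices_near_extremal _ \<longleftrightarrow>
     (\<forall>n\<ge>1. \<forall>(f :: nat \<Rightarrow> 'a \<Rightarrow>\<^sub>L real) \<alpha> \<epsilon>. \<alpha> > 0 \<longrightarrow> \<epsilon> > 0 \<longrightarrow>
       (\<exists>x. (\<forall>i\<in>{1..n}. x i \<in> slice (f i) \<alpha>) \<and> norm (\<Sum>i=1..n. x i) > real n * (1 - \<epsilon>)))"

lemma convex_comb_of_slices_subset_cball:
  assumes "is_convex_comb_of_slices C"
  shows "C \<subseteq> cball 0 1"
proof
  fix c assume "c \<in> C"
  with assms obtain n \<mu> S x where *: "\<forall>i\<in>{1..n}. \<mu> i > 0" "(\<Sum>i=1..n. \<mu> i) = (1::real)"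
    "\<forall>i\<in>{1..n}. is_slice (S i)" "\<forall>i\<in>{1..n}. x i \<in> S i" "c = (\<Sum>i=1..n::nat. \<mu> i *\<^sub>R x i)"
    unfolding is_convex_comb_of_slices_def by blast
  have "x i \<in> cball 0 1" if "i \<in> {1..n}" for i
    using *(3,4) that by (force simp: is_slice_def mem_slice)
  thus "c \<in> cball 0 1"
    unfolding *(5) using *(1,2) by (intro convex_sum) (auto intro: less_imp_le)
qed

text \<open>The average of the slices with equal weights has two points more than 2 - \<epsilon>
  apart; the second has norm at most 1, so the first has norm above 1 - \<epsilon>.\<close>

lemma SD2P_imp_slices_near_extremal:
  assumes "SD2P TYPE('a::real_normed_vector)"
  shows "slices_near_extremal TYPE('a)"
  unfolding slices_near_extremal_def
proof (intro allI impI)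
  fix n :: nat and f :: "nat \<Rightarrow> 'a \<Rightarrow>\<^sub>L real" and \<alpha> \<epsilon> :: real
  assume n: "n \<ge> 1" and pos: "\<alpha> > 0" "\<epsilon> > 0"
  define C where "C = {(\<Sum>i=1..n. (1 / real n) *\<^sub>R x i) | x. \<forall>i\<in>{1..n}. x i \<in> slice (f i) \<alpha>}"
  have C: "is_convex_comb_of_slices C"
    unfolding is_convex_comb_of_slices_def C_def
    by (rule exI[of _ n], rule exI[of _ "\<lambda>_. 1 / real n"], rule exI[of _ "\<lambda>i. slice (f i) \<alpha>"])
      (use n pos in \<open>auto simp: is_slice_def\<close>)
  hence diam: "diameter C = 2" using assms by (simp add: SD2P_def)
  have "bounded C" using convex_comb_of_slices_subset_cball[OF C] bounded_cball by (rule bounded_subset[rotated])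
  \<comment> \<open>The maximum with 1 keeps the bound positive when \<epsilon> is 2 or
    more.\<close>
  moreover have "0 < max 1 (2 - \<epsilon>)" "max 1 (2 - \<epsilon>) < diameter C"
    using pos diam by auto
  ultimately obtain c d where cd: "c \<in> C" "d \<in> C" "max 1 (2 - \<epsilon>) < dist c d"
    using diameter_lower_bounded by blast
  then obtain x where x: "\<forall>i\<in>{1..n}. x i \<in> slice (f i) \<alpha>" "c = (\<Sum>i=1..n. (1 / real n) *\<^sub>R x i)"
    unfolding C_def by blast
  have "norm d \<le> 1" using convex_comb_of_slices_subset_cball[OF C] cd by auto
  hence "1 - \<epsilon> < norm c"
    using cd(3) norm_triangle_ineq4[of c d] by (auto simp: dist_norm)
  also have "norm c = norm (\<Sum>i=1..n. x i) / n"
    by (simp add: x flip: scaleR_sum_right)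
  finally have "norm (\<Sum>i=1..n. x i) > real n * (1 - \<epsilon>)"
    using n by (simp add: field_simps)
  thus "\<exists>x. (\<forall>i\<in>{1..n}. x i \<in> slice (f i) \<alpha>) \<and> norm (\<Sum>i=1..n. x i) > real n * (1 - \<epsilon>)"
    using x by blast
qed

text \<open>Near extremality is applied to 2n slices, the given ones and their reflections. This
  gives two points x_i, y_i in each slice such that the sum of all x_i - y_i has norm nearly 2n, and
  passing to the weights loses at most 2 (n - 1), which leaves nearly 2.\<close>

lemma slices_near_extremal_imp_SD2P:
  assumes near: "slices_near_extremal TYPE('a::real_normed_vector)"
  shows "SD2P TYPE('a)"
  unfolding SD2P_def
proof (intro allI impI antisym)
  fix C :: "'a set" assume C: "is_convex_comb_of_slices C"
  note ball = convex_comb_of_slices_subset_cball[OF C]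
  show "diameter C \<le> 2"
  proof (rule diameter_le)
    fix x y assume "x \<in> C" "y \<in> C"
    hence "norm x \<le> 1" "norm y \<le> 1" using ball by auto
    thus "norm (x - y) \<le> 2" using norm_triangle_ineq4[of x y] by simp
  qed simp
  have bdd: "bounded C" using ball bounded_cball by (rule bounded_subset[rotated])
  from C obtain n \<mu> S where n: "n \<ge> 1" and \<mu>: "\<forall>i\<in>{1..n}. \<mu> i > 0" "(\<Sum>i=1..n. \<mu> i) = (1::real)"
    and S: "\<forall>i\<in>{1..n}. is_slice (S i)"
    and C_eq: "C = {(\<Sum>i=1..n::nat. \<mu> i *\<^sub>R x i) | x. \<forall>i\<in>{1..n}. x i \<in> S i}"
    unfolding is_convex_comb_of_slices_def by blast
  from S have "\<forall>i\<in>{1..n}. \<exists>f \<alpha>. \<alpha> > 0 \<and> S i = slice f \<alpha>"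
    by (simp add: is_slice_def)
  then obtain f \<alpha>s where f: "\<forall>i\<in>{1..n}. \<alpha>s i > 0 \<and> S i = slice (f i) (\<alpha>s i)"
    by metis
  define \<alpha> where "\<alpha> = Min (\<alpha>s ` {1..n})"
  have \<alpha>: "\<alpha> > 0" using n f by (auto simp: \<alpha>_def)
  have slice_sub: "slice (f i) \<alpha> \<subseteq> S i" if "i \<in> {1..n}" for i
  proof -
    have "\<alpha> \<le> \<alpha>s i" using that by (auto simp: \<alpha>_def)
    thus ?thesis using f that by (auto simp: mem_slice)
  qed
  have \<mu>_le: "\<mu> i \<le> 1" if "i \<in> {1..n}" for i
  proof -
    have "\<mu> i \<le> (\<Sum>i=1..n. \<mu> i)"
      using \<mu>(1) that by (intro member_le_sum) (auto intro: less_imp_le)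
    thus ?thesis using \<mu>(2) by simp
  qed
  show "2 \<le> diameter C"
  proof (rule field_le_epsilon)
    fix e :: real assume e: "e > 0"
    \<comment> \<open>Chosen so that 2n (1 - \<epsilon>) = 2n - e.\<close>
    define \<epsilon> where "\<epsilon> = e / (2 * n)"
    have \<epsilon>: "\<epsilon> > 0" using e n by (simp add: \<epsilon>_def)
    \<comment> \<open>The indices n + 1 to 2n carry the reflected slices.\<close>
    define g where "g i = (if i \<le> n then f i else - f (i - n))" for i
    obtain x where x: "\<forall>i\<in>{1..n+n}. x i \<in> slice (g i) \<alpha>"
      "norm (\<Sum>i=1..n+n. x i) > real (n + n) * (1 - \<epsilon>)"
      using near n \<alpha> \<epsilon> unfolding slices_near_extremal_def
      by (metis le_add1 order_trans)
    define y where "y i = - x (i + n)" for i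
    have xi: "x i \<in> slice (f i) \<alpha>" if "i \<in> {1..n}" for i
      using x(1)[rule_format, of i] that by (simp add: g_def)
    have yi: "y i \<in> slice (f i) \<alpha>" if "i \<in> {1..n}" for i
      using x(1)[rule_format, of "i + n"] that by (simp add: g_def y_def slice_uminus)
    \<comment> \<open>Halving puts the differences into the unit ball, as the estimate for weighted
      sums requires.\<close>
    have "norm ((1/2) *\<^sub>R (x i - y i)) \<le> 1" if "i \<in> {1..n}" for i
      using norm_triangle_ineq4[of "x i" "y i"] xi[OF that] yi[OF that] by (simp add: mem_slice)
    hence "norm (\<Sum>i=1..n. (1/2) *\<^sub>R (x i - y i)) - (\<Sum>i=1..n. 1 - \<mu> i)
        \<le> norm (\<Sum>i=1..n. \<mu> i *\<^sub>R ((1/2) *\<^sub>R (x i - y i)))"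
      using \<mu>_le by (intro norm_weighted_sum_ge) auto
    also have "(\<Sum>i=1..n. 1 - \<mu> i) = real n - 1"
      using \<mu>(2) by (simp add: sum_subtractf)
    also have "(\<Sum>i=1..n. (1/2) *\<^sub>R (x i - y i)) = (1/2) *\<^sub>R (\<Sum>i=1..n+n. x i)"
    proof -
      have "(\<Sum>i=1..n+n. x i) = (\<Sum>i=1..n. x i) + (\<Sum>i=1+n..n+n. x i)"
        using sum.ub_add_nat[of 1 n x n] by simp
      also have "(\<Sum>i=1+n..n+n. x i) = (\<Sum>i=1..n. - y i)"
        unfolding sum.shift_bounds_cl_nat_ivl by (simp add: y_def)
      finally show ?thesis
        by (simp add: sum_negf sum_subtractf flip: scaleR_sum_right)
    qed
    also have "(\<Sum>i=1..n. \<mu> i *\<^sub>R ((1/2) *\<^sub>R (x i - y i)))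
        = (1/2) *\<^sub>R ((\<Sum>i=1..n. \<mu> i *\<^sub>R x i) - (\<Sum>i=1..n. \<mu> i *\<^sub>R y i))"
      by (simp add: scaleR_sum_right scaleR_diff_right sum_subtractf mult.commute)
    finally have "norm (\<Sum>i=1..n+n. x i) - 2 * (real n - 1)
        \<le> dist (\<Sum>i=1..n. \<mu> i *\<^sub>R x i) (\<Sum>i=1..n. \<mu> i *\<^sub>R y i)"
      by (simp add: dist_norm)
    moreover have "dist (\<Sum>i=1..n. \<mu> i *\<^sub>R x i) (\<Sum>i=1..n. \<mu> i *\<^sub>R y i) \<le> diameter C"
      unfolding C_eq using xi yi slice_sub by (intro diameter_bounded_bound[OF bdd[unfolded C_eq]]) blast+
    moreover have "real (n + n) * (1 - \<epsilon>) = 2 * real n - e"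
      using n by (simp add: \<epsilon>_def field_simps)
    ultimately show "2 \<le> diameter C + e" using x(2) by simp
  qed
qed

section \<open>Coordinate functionals on tuples, and the passage between slices and closed convex
  hulls\<close>

section \<open>Functionals on tuples\<close>

lemma bounded_linear_apply_bcontfun:
  "bounded_linear (\<lambda>z :: 'i::topological_space \<Rightarrow>\<^sub>C 'a::real_normed_vector. apply_bcontfun z i)"
  by (rule bounded_linear_intro[where K = 1]) (simp_all add: norm_bounded)

text \<open>Each \<open>f i\<close> is \<open>F\<close> composed with the embedding
  \<open>e i\<close> of the i-th coordinate; a tuple is the sum of its embedded coordinates because
  it vanishes outside \<open>{1..n}\<close>.\<close>

lemma ell_inf_functional:
  fixes F :: "(nat \<Rightarrow>\<^sub>C 'a::real_normed_vector) \<Rightarrow>\<^sub>L real"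
  obtains f :: "nat \<Rightarrow> 'a \<Rightarrow>\<^sub>L real"
  where "\<And>z. z \<in> ell_inf n \<Longrightarrow> F z = (\<Sum>i=1..n. f i (apply_bcontfun z i))"
proof -
  define e :: "nat \<Rightarrow> 'a \<Rightarrow> nat \<Rightarrow>\<^sub>C 'a" where "e i x = Bcontfun (\<lambda>j. if j = i then x else 0)" for i x
  have e: "apply_bcontfun (e i x) = (\<lambda>j. if j = i then x else 0)" for i x
    unfolding e_def by (intro Bcontfun_inverse bcontfun_normI[where b = "norm x"]) auto
  have bl: "bounded_linear (\<lambda>x. F (e i x))" for i
  proof (rule bounded_linear_compose[OF blinfun.bounded_linear_right])
    show "bounded_linear (e i)"
    proof (rule bounded_linear_intro[where K = 1])
      show "norm (e i x) \<le> norm x * 1" for x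
        by (rule norm_bound) (simp add: e)
    qed (auto intro!: bcontfun_eqI simp: e)
  qed
  define f where "f i = Blinfun (\<lambda>x. F (e i x))" for i
  have "F z = (\<Sum>i=1..n. f i (apply_bcontfun z i))" if z: "z \<in> ell_inf n" for z
  proof -
    have "apply_bcontfun (\<Sum>i=1..n. e i (apply_bcontfun z i)) j
        = (\<Sum>i=1..n. apply_bcontfun (e i (apply_bcontfun z i)) j)" for j
      using bounded_linear_apply_bcontfun by (rule linear_sum[OF bounded_linear.linear])
    hence "z = (\<Sum>i=1..n. e i (apply_bcontfun z i))"
      using z by (intro bcontfun_eqI) (auto simp: e ell_inf_def)
    hence "F z = F (\<Sum>i=1..n. e i (apply_bcontfun z i))" by simp
    thus ?thesis by (simp add: f_def bounded_linear_Blinfun_apply[OF bl] blinfun.sum_right)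
  qed
  thus ?thesis using that by blast
qed

lemma unit_ball_ell_inf_eq: "unit_ball_ell_inf n = ell_inf n \<inter> cball 0 1"
  by (auto simp: unit_ball_ell_inf_def)

lemma closed_unit_ball_ell_inf: "closed (unit_ball_ell_inf n)"
  by (simp add: unit_ball_ell_inf_eq closed_Int closed_ell_inf)

lemma convex_unit_ball_ell_inf: "convex (unit_ball_ell_inf n)"
  by (simp add: unit_ball_ell_inf_eq convex_Int subspace_imp_convex subspace_ell_inf)

lemma C_set_subset_unit_ball: "C_set n \<epsilon> \<subseteq> unit_ball_ell_inf n"
  by (auto simp: C_set_def unit_ball_ell_inf_def)

lemma C_set_subset_C_plus_set: "\<epsilon> > 0 \<Longrightarrow> C_set n \<epsilon> \<subseteq> C_plus_set n \<epsilon>"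
  by (auto simp: C_set_def C_plus_set_def)

text \<open>A separating \<open>F\<close> splits into coordinate functionals \<open>f i\<close>.
  Near-extremal points of their slices form a tuple in \<open>C_set n \<epsilon>\<close> at which
  \<open>F\<close> almost reaches the sum of the norms of the \<open>f i\<close>, the largest value
  possible on the ball, and so exceeds the separating bound b.\<close>

lemma unit_ball_subset_closure_C_set:
  assumes near: "slices_near_extremal TYPE('a::real_normed_vector)" and n: "n \<ge> 1" and \<epsilon>: "\<epsilon> > 0"
  shows "(unit_ball_ell_inf n :: (nat \<Rightarrow>\<^sub>C 'a) set) \<subseteq> closure (convex hull C_set n \<epsilon>)"
proof (rule subsetI, rule ccontr)
  fix z :: "nat \<Rightarrow>\<^sub>C 'a"
  let ?K = "closure (convex hull C_set n \<epsilon>) :: (nat \<Rightarrow>\<^sub>C 'a) set"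
  assume z: "z \<in> unit_ball_ell_inf n" and "z \<notin> ?K"
  have K: "closed ?K" "convex ?K" by (simp_all add: convex_closure convex_convex_hull)
  obtain F :: "(nat \<Rightarrow>\<^sub>C 'a) \<Rightarrow>\<^sub>L real" and b where F: "\<And>k. k \<in> ?K \<Longrightarrow> F k \<le> b" "b < F z"
    by (rule separating_blinfun[OF K \<open>z \<notin> ?K\<close>]) blast
  obtain f :: "nat \<Rightarrow> 'a \<Rightarrow>\<^sub>L real"
    where f: "\<And>z. z \<in> ell_inf n \<Longrightarrow> F z = (\<Sum>i=1..n. f i (apply_bcontfun z i))"
    using ell_inf_functional by blast
  \<comment> \<open>The losses in the n slices then add up to the separation gap F z - b.\<close>
  define \<alpha> where "\<alpha> = (F z - b) / n"
  have "\<alpha> > 0" using F(2) n by (simp add: \<alpha>_def)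
  with near n \<epsilon> obtain x where x: "\<forall>i\<in>{1..n}. x i \<in> slice (f i) \<alpha>"
    "norm (\<Sum>i=1..n. x i) > real n * (1 - \<epsilon>)"
    unfolding slices_near_extremal_def by blast
  obtain c where c: "c \<in> ell_inf n" "\<forall>i\<in>{1..n}. apply_bcontfun c i = x i"
    using ell_inf_tuple[of n x] by blast
  have "norm c \<le> 1"
  proof (rule norm_bound)
    show "norm (apply_bcontfun c i) \<le> 1" for i
      using c x(1) by (cases "i \<in> {1..n}") (simp_all add: mem_slice ell_inf_def)
  qed
  hence "c \<in> C_set n \<epsilon>"
    using c x n by (simp add: C_set_def field_simps)
  hence "F c \<le> b"
    by (intro F(1) subsetD[OF closure_subset] hull_inc)
  moreover have "(\<Sum>i=1..n. norm (f i) - \<alpha>) < F c"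
    unfolding f[OF c(1)] using c(2) x(1) n by (intro sum_strict_mono) (auto simp: mem_slice)
  moreover have "(\<Sum>i=1..n. norm (f i) - \<alpha>) = (\<Sum>i=1..n. norm (f i)) - (F z - b)"
    using n by (simp add: sum_subtractf \<alpha>_def)
  moreover have "F z \<le> (\<Sum>i=1..n. norm (f i))"
  proof -
    have "norm (apply_bcontfun z i) \<le> 1" for i
      using z norm_bounded[of z i] by (auto simp: unit_ball_ell_inf_def)
    hence "f i (apply_bcontfun z i) \<le> norm (f i)" for i
      using blinfun_le_norm[of _ 1 "f i"] by simp
    moreover have "z \<in> ell_inf n" using z by (simp add: unit_ball_ell_inf_def)
    ultimately show ?thesis by (simp add: f sum_mono)
  qed
  ultimately show False by simp
qed

text \<open>A tuple of points in thin slices lies in the closed hull, so some c in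
  \<open>C_plus_set n \<delta>\<close> makes the sum \<open>F\<close> of the \<open>f i\<close>
  nearly maximal. As the other coordinates cannot exceed their norms by more than the factor 1 +
  \<delta>, each coordinate of c nearly attains the norm of its own functional.\<close>

lemma unit_ball_subset_closure_C_plus_set_imp_near_extremal:
  assumes sub: "\<And>n \<epsilon>. n \<ge> 1 \<Longrightarrow> \<epsilon> > 0 \<Longrightarrow>
    (unit_ball_ell_inf n :: (nat \<Rightarrow>\<^sub>C 'a::real_normed_vector) set) \<subseteq> closure (convex hull C_plus_set n \<epsilon>)"
  shows "slices_near_extremal TYPE('a)"
  unfolding slices_near_extremal_def
proof (intro allI impI)
  fix n :: nat and f :: "nat \<Rightarrow> 'a \<Rightarrow>\<^sub>L real" and \<alpha> \<epsilon> :: real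
  assume n: "n \<ge> 1" and pos: "\<alpha> > 0" "\<epsilon> > 0"
  define s where "s = (\<Sum>i=1..n. norm (f i))"
  have s: "s \<ge> 0" by (simp add: s_def sum_nonneg)
  \<comment> \<open>The constants give n \<eta> = \<alpha> / 2, \<delta> s \<le> \<alpha> / 4 and 2
    \<delta> \<le> \<epsilon>, so the total loss stays below \<alpha>. The term s + 1 avoids
    dividing by 0 when all functionals vanish.\<close>
  define \<eta> where "\<eta> = \<alpha> / (2 * n)"
  define \<delta> where "\<delta> = min (\<epsilon> / 2) (\<alpha> / (4 * (s + 1)))"
  have \<eta>: "\<eta> > 0" and \<delta>: "\<delta> > 0" using n pos s by (simp_all add: \<eta>_def \<delta>_def)
  have "\<delta> * s \<le> \<alpha> / (4 * (s + 1)) * (s + 1)"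
    using s pos by (intro mult_mono) (auto simp: \<delta>_def)
  also have "\<dots> = \<alpha> / 4" using s by (simp add: divide_simps)
  finally have \<delta>s: "\<delta> * s \<le> \<alpha> / 4" .
  define F where "F c = (\<Sum>i=1..n. f i (apply_bcontfun c i))" for c
  have F: "bounded_linear F"
    unfolding F_def
    by (intro bounded_linear_sum bounded_linear_compose[OF blinfun.bounded_linear_right]
        bounded_linear_apply_bcontfun)
  have "\<forall>i. \<exists>x. x \<in> slice (f i) \<eta>" using slice_nonempty[OF \<eta>] by blast
  then obtain x where x: "\<And>i. x i \<in> slice (f i) \<eta>" by metis
  obtain z where z: "z \<in> ell_inf n" "\<forall>i\<in>{1..n}. apply_bcontfun z i = x i"
    using ell_inf_tuple[of n x] by blast
  have "norm z \<le> 1"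
  proof (rule norm_bound)
    show "norm (apply_bcontfun z i) \<le> 1" for i
      using z x[of i] by (cases "i \<in> {1..n}") (simp_all add: mem_slice ell_inf_def)
  qed
  hence "z \<in> unit_ball_ell_inf n" using z by (simp add: unit_ball_ell_inf_def)
  hence z_cl: "z \<in> closure (convex hull C_plus_set n \<delta>)" using sub[OF n \<delta>] by blast
  have Fz: "s - n * \<eta> < F z"
  proof -
    have "(\<Sum>i=1..n. norm (f i) - \<eta>) < F z"
      unfolding F_def using z(2) x n by (intro sum_strict_mono) (auto simp: mem_slice)
    thus ?thesis by (simp add: sum_subtractf s_def)
  qed
  \<comment> \<open>Otherwise a closed half-space would contain
    \<open>C_plus_set n \<delta>\<close>, hence its closed convex hull, but not z.\<close>
  obtain c where c: "c \<in> C_plus_set n \<delta>" "s - n * \<eta> < F c"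
  proof (rule ccontr)
    assume "\<not> thesis"
    hence "C_plus_set n \<delta> \<subseteq> F -` {..s - n * \<eta>}" using that by force
    moreover have "convex (F -` {..s - n * \<eta>})"
      using bounded_linear.linear[OF F] by (intro convex_linear_vimage) auto
    moreover have "closed (F -` {..s - n * \<eta>})"
      using linear_continuous_at[OF F] by (intro continuous_closed_vimage) auto
    ultimately have "closure (convex hull C_plus_set n \<delta>) \<subseteq> F -` {..s - n * \<eta>}"
      by (intro closure_minimal hull_minimal)
    thus False using z_cl Fz by auto
  qed
  let ?c = "\<lambda>i. apply_bcontfun c i"
  define y where "y i = (1 / (1 + \<delta>)) *\<^sub>R ?c i" for i
  have norm_c: "norm (?c i) \<le> 1 + \<delta>" for i
    using norm_bounded[of c i] c(1) by (simp add: C_plus_set_def)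
  have "y i \<in> slice (f i) \<alpha>" if i: "i \<in> {1..n}" for i
  proof -
    have split: "(\<Sum>j=1..n. g j) = g i + (\<Sum>j\<in>{1..n} - {i}. g j)" for g :: "nat \<Rightarrow> real"
      using i by (intro sum.remove) auto
    have "norm (f i) \<le> s"
      unfolding s_def using i by (intro member_le_sum) auto
    hence "\<delta> * norm (f i) \<le> \<alpha> / 4"
      using \<delta>s \<delta> by (meson less_imp_le mult_left_mono order_trans)
    \<comment> \<open>All coordinates but the i-th are estimated by their largest possible value,
      which leaves a lower bound for the i-th.\<close>
    moreover have "F c \<le> f i (?c i) + (\<Sum>j\<in>{1..n} - {i}. norm (f j) * (1 + \<delta>))"
      unfolding F_def split by (intro add_left_mono sum_mono blinfun_le_norm norm_c)
    moreover have "(\<Sum>j\<in>{1..n} - {i}. norm (f j) * (1 + \<delta>)) = (s - norm (f i)) * (1 + \<delta>)"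
      using split[of "\<lambda>j. norm (f j)"] by (simp add: s_def flip: sum_distrib_right)
    moreover have "real n * \<eta> = \<alpha> / 2" using n by (simp add: \<eta>_def)
    moreover have "\<delta> * \<alpha> > 0" using \<delta> pos by simp
    ultimately have "(norm (f i) - \<alpha>) * (1 + \<delta>) < f i (?c i)"
      using c(2) \<delta>s pos by (simp add: algebra_simps)
    thus ?thesis
      using norm_c[of i] \<delta> by (simp add: y_def mem_slice blinfun.scaleR_right field_simps)
  qed
  moreover have "real n * (1 - \<epsilon>) < norm (\<Sum>i=1..n. y i)"
  proof -
    \<comment> \<open>Dividing by 1 + \<delta> lowers the mean's bound 1 - \<delta> to (1 -
      \<delta>) / (1 + \<delta>), which is still at least 1 - 2 \<delta>.\<close>
    have "1 - \<epsilon> \<le> 1 - 2 * \<delta>" by (simp add: \<delta>_def)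
    also have "\<dots> \<le> (1 - \<delta>) / (1 + \<delta>)" using \<delta> by (simp add: field_simps)
    finally have "real n * (1 - \<epsilon>) \<le> real n * (1 - \<delta>) / (1 + \<delta>)"
      using n by (simp add: mult_left_mono flip: times_divide_eq_right)
    also have "\<dots> < norm (\<Sum>i=1..n. ?c i) / (1 + \<delta>)"
      using c(1) n \<delta> by (intro divide_strict_right_mono) (simp_all add: C_plus_set_def field_simps)
    also have "\<dots> = norm (\<Sum>i=1..n. y i)"
      using \<delta> by (simp add: y_def flip: scaleR_sum_right)
    finally show ?thesis .
  qed
  ultimately show "\<exists>x. (\<forall>i\<in>{1..n}. x i \<in> slice (f i) \<alpha>) \<and> norm (\<Sum>i=1..n. x i) > real n * (1 - \<epsilon>)"
    by blast
qed

theorem theorem3p6: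
  shows "(SD2P TYPE('a::banach) \<longleftrightarrow>
           (\<forall>n\<ge>1. \<forall>\<epsilon>>0. (unit_ball_ell_inf n :: (nat \<Rightarrow>\<^sub>C 'a) set) = closure (convex hull (C_set n \<epsilon>))))
       \<and> (SD2P TYPE('a) \<longleftrightarrow>
           (\<forall>n\<ge>1. \<forall>\<epsilon>>0. (unit_ball_ell_inf n :: (nat \<Rightarrow>\<^sub>C 'a) set) \<subseteq> closure (convex hull (C_plus_set n \<epsilon>))))"
  (is "(?SD2P \<longleftrightarrow> ?C) \<and> (_ \<longleftrightarrow> ?C_plus)")
proof -
  \<comment> \<open>The implications are proved in a cycle: (1) to (2), (2) to (3), (3) to
    (1).\<close>
  have "?SD2P \<Longrightarrow> ?C"
  proof (intro allI impI equalityI)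
    fix n :: nat and \<epsilon> :: real assume "?SD2P" "n \<ge> 1" "\<epsilon> > 0"
    thus "(unit_ball_ell_inf n :: (nat \<Rightarrow>\<^sub>C 'a) set) \<subseteq> closure (convex hull C_set n \<epsilon>)"
      by (intro unit_ball_subset_closure_C_set SD2P_imp_slices_near_extremal)
    show "closure (convex hull C_set n \<epsilon>) \<subseteq> (unit_ball_ell_inf n :: (nat \<Rightarrow>\<^sub>C 'a) set)"
      by (intro closure_minimal hull_minimal C_set_subset_unit_ball closed_unit_ball_ell_inf
          convex_unit_ball_ell_inf)
  qed
  moreover have "?C_plus" if ?C
  proof (intro allI impI)
    fix n :: nat and \<epsilon> :: real assume "n \<ge> 1" and \<epsilon>: "\<epsilon> > 0"
    hence "unit_ball_ell_inf n = closure (convex hull (C_set n \<epsilon> :: (nat \<Rightarrow>\<^sub>C 'a) set))"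
      using that by blast
    also have "\<dots> \<subseteq> closure (convex hull (C_plus_set n \<epsilon>))"
      using \<epsilon> by (intro closure_mono hull_mono C_set_subset_C_plus_set)
    finally show "(unit_ball_ell_inf n :: (nat \<Rightarrow>\<^sub>C 'a) set) \<subseteq> closure (convex hull (C_plus_set n \<epsilon>))" .
  qed
  moreover have "?C_plus \<Longrightarrow> ?SD2P"
    by (intro slices_near_extremal_imp_SD2P unit_ball_subset_closure_C_plus_set_imp_near_extremal) blast
  ultimately show ?thesis by blast
qed

end
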